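(* Let $k\ge2$ be an integer, let $T$ be the infinite rooted $k$-ary tree, and let $p>1$. If $$w(x)=\sum_{j=0}^{\infty}k^{j(p-1)}\chi_{T_{j}}(x),$$ then for all functions $f$ on $T$ $$\|Mf\|_{L^{p,\infty}(w)}\lesssim\|f\|_{L^{p}(w)},$$ and also, for every $q$ with $p<q<\infty$ and all functions $f$ on $T$, $$\|Mf\|_{L^{q}(w)}\lesssim\|f\|_{L^{q}(w)}\qquad\text{and}\qquad\|Mf\|_{L^{q'}(\sigma_{q})}\lesssim\|f\|_{L^{q'}(\sigma_{q})},$$ where $\sigma_q=w^{-\frac{1}{q-1}}$ and $q'=\frac{q}{q-1}$.
   Context: For an integer $k\ge2$, $T$ denotes (the vertex set of) the infinite rooted $k$-ary tree, in which every vertex has exactly $k$ children; $d(x,y)$ is the number of edges on the unique path between $x$ and $y$. $T_0$ is the set consisting of the root, and $T_j$ is the set of children of vertices in $T_{j-1}$ for $j\ge1$; $\chi_A$ is the indicator function of $A$. $|A|$ is the cardinality of $A$ and $B(x,r)=\{y\in T: d(x,y)\le r\}$. The centered maximal function is $Mf(x)=\sup_{r\in\mathbb{N}\cup\{0\}}\frac{1}{|B(x,r)|}\sum_{y\in B(x,r)}|f(y)|$. For $w:T\to(0,\infty)$ and $A\subset T$, $w(A)=\sum_{x\in A}w(x)$. For $0<q<\infty$, $\|f\|_{L^q(w)}=\left(\sum_{x\in T}|f(x)|^q w(x)\right)^{1/q}$ and $\|f\|_{L^{q,\infty}(w)}=\sup_{\lambda>0}\lambda\, w(\{x\in T:|f(x)|>\lambda\})^{1/q}$.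 The notation $A\lesssim B$ means $A\le CB$ for a finite constant $C$ independent of $f$. *)

theory Defs
  imports "HOL-Analysis.Analysis" "HOL-Library.Sublist"
begin

(* The infinite rooted k-ary tree. A vertex is the word of child indices read from the vertex
   back to the root, so the root is [] and the parent of i # x is x. *)

type_synonym vertex = "nat list"

definition tree :: "nat \<Rightarrow> vertex set" where
  "tree k = lists {..<k}"

definition children :: "nat \<Rightarrow> vertex \<Rightarrow> vertex set" where
  "children k x = {i # x |i. i < k}"

primrec tree_level :: "nat \<Rightarrow> nat \<Rightarrow> vertex set" where
  "tree_level k 0 = {[]}"
| "tree_level k (Suc j) = (\<Union>x\<in>tree_level k j. children k x)"

definition tree_adj :: "nat \<Rightarrow> vertex \<Rightarrow> vertex \<Rightarrow> bool" where
  "tree_adj k x y \<longleftrightarrow> y \<in> children k x \<or> x \<in> children k y"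

definition tree_path :: "nat \<Rightarrow> vertex \<Rightarrow> vertex \<Rightarrow> vertex list \<Rightarrow> bool" where
  "tree_path k x y ps \<longleftrightarrow> ps \<noteq> [] \<and> hd ps = x \<and> last ps = y \<and> distinct ps
     \<and> set ps \<subseteq> tree k \<and> successively (tree_adj k) ps"

(* Number of edges of the unique path; existence and uniqueness for vertices of the tree are
   proved in ex1_tree_path below. *)
definition tree_dist :: "nat \<Rightarrow> vertex \<Rightarrow> vertex \<Rightarrow> nat" where
  "tree_dist k x y = length (THE ps. tree_path k x y ps) - 1"

definition tree_ball :: "nat \<Rightarrow> vertex \<Rightarrow> nat \<Rightarrow> vertex set" where
  "tree_ball k x r = {y \<in> tree k. tree_dist k x y \<le> r}"

(* Functions on the tree are functions on all words; every notion below only uses their values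
   on vertices of the tree. The values of M and of the (quasi-)norms may be infinite. *)

definition maximal :: "nat \<Rightarrow> (vertex \<Rightarrow> complex) \<Rightarrow> vertex \<Rightarrow> ennreal" where
  "maximal k f x =
     (SUP r::nat. ennreal (1 / real (card (tree_ball k x r)) * (\<Sum>y\<in>tree_ball k x r. norm (f y))))"

(* Real power on [0, \<infinity>], used for positive exponents only. *)
definition epowr :: "ennreal \<Rightarrow> real \<Rightarrow> ennreal" where
  "epowr a q = (if a = \<infinity> then \<infinity> else ennreal (enn2real a powr q))"

definition weight_of :: "(vertex \<Rightarrow> real) \<Rightarrow> vertex set \<Rightarrow> ennreal" where
  "weight_of w A = (\<integral>\<^sup>+x. ennreal (w x) \<partial>count_space A)"

(* The norms take the modulus of the function as argument. *)

definition Lq_norm :: "nat \<Rightarrow> real \<Rightarrow> (vertex \<Rightarrow> real) \<Rightarrow> (vertex \<Rightarrow> ennreal) \<Rightarrow> ennreal" where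
  "Lq_norm k q w g = epowr (\<integral>\<^sup>+x. epowr (g x) q * ennreal (w x) \<partial>count_space (tree k)) (1 / q)"

definition weak_Lq_norm :: "nat \<Rightarrow> real \<Rightarrow> (vertex \<Rightarrow> real) \<Rightarrow> (vertex \<Rightarrow> ennreal) \<Rightarrow> ennreal" where
  "weak_Lq_norm k q w g =
     (SUP l\<in>{0::real<..}. ennreal l * epowr (weight_of w {x \<in> tree k. g x > ennreal l}) (1 / q))"

lemma tree_level_eq: "tree_level k j = {x \<in> tree k. length x = j}"
proof (induction j)
  case 0
  then show ?case by (auto simp: tree_def)
next
  case (Suc j)
  then show ?case by (auto simp: tree_def children_def length_Suc_conv)
qed

lemma tree_path_Cons_Cons:
  "tree_path k x y (a # b # ps) \<longleftrightarrow>
     x = a \<and> a \<in> tree k \<and> a \<noteq> b \<and> a \<notin> set ps \<and> tree_adj k a b \<and> tree_path k b y (b # ps)"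
  by (auto simp: tree_path_def)

lemma tree_path_singleton: "tree_path k x y [a] \<longleftrightarrow> x = a \<and> y = a \<and> a \<in> tree k"
  by (auto simp: tree_path_def)

lemma tree_path_descends:
  assumes "tree_path k x y (x # b # ps)" "b \<in> children k x"
  shows "suffix b y"
  using assms
proof (induction ps arbitrary: x b)
  case Nil
  then show ?case by (auto simp: tree_path_def)
next
  case (Cons c ps)
  have "c \<in> children k b"
    using Cons.prems by (auto simp: tree_path_def tree_adj_def children_def)
  moreover have "tree_path k b y (b # c # ps)"
    using Cons.prems(1) by (simp add: tree_path_Cons_Cons)
  ultimately have "suffix c y" using Cons.IH by blast
  moreover have "suffix b c" using \<open>c \<in> children k b\<close> by (auto simp: children_def suffix_def)
  ultimately show ?case using suffix_order.trans by blast
qed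

lemma tree_path_enters_subtree:
  assumes "tree_path k b y ps" "\<not> suffix x b" "suffix x y"
  shows "x \<in> set ps"
  using assms
proof (induction ps arbitrary: b)
  case Nil
  then show ?case by (auto simp: tree_path_def)
next
  case (Cons u ps)
  show ?case
  proof (cases ps)
    case Nil
    with Cons.prems show ?thesis by (auto simp: tree_path_singleton)
  next
    case (Cons v qs)
    note ps = this
    have p: "u = b" "tree_adj k u v" "tree_path k v y ps"
      using Cons.prems(1) ps by (auto simp: tree_path_Cons_Cons)
    show ?thesis
    proof (cases "suffix x v")
      case False
      then show ?thesis using Cons.IH p(3) Cons.prems(3) by auto
    next
      case True
      have "x = v"
        using True p(1,2) Cons.prems(2)
        by (auto simp: tree_adj_def children_def suffix_Cons)
      then show ?thesis using ps by auto
    qed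
  qed
qed

lemma tree_path_unique:
  "tree_path k x y ps \<Longrightarrow> tree_path k x y qs \<Longrightarrow> ps = qs"
proof (induction ps arbitrary: x qs)
  case Nil
  then show ?case by (auto simp: tree_path_def)
next
  case (Cons a ps)
  have a: "a = x" using Cons.prems by (auto simp: tree_path_def)
  obtain qs' where qs: "qs = x # qs'"
    using Cons.prems(2) by (cases qs) (auto simp: tree_path_def)
  have swap: False
    if "tree_path k x y (x # b # us)" "tree_path k x y (x # c # vs)"
       "b \<in> children k x" "c \<notin> children k x" for b c us vs
  proof -
    have "suffix b y" using tree_path_descends that(1,3) by blast
    then have "suffix x y"
      using that(3) unfolding children_def by (blast dest: suffix_ConsD)
    moreover have "\<not> suffix x c"
      using that(2,4) by (auto simp: tree_path_Cons_Cons tree_adj_def children_def suffix_def)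
    ultimately have "x \<in> set (c # vs)"
      using tree_path_enters_subtree[of k c y "c # vs" x] that(2)
      by (auto simp: tree_path_Cons_Cons)
    then show False using that(2) by (auto simp: tree_path_Cons_Cons)
  qed
  show ?case
  proof (cases "ps = [] \<or> qs' = []")
    case True
    then have "ps = [] \<and> qs' = []"
      using Cons.prems a qs by (metis distinct.simps(2) last.simps last_in_set tree_path_def)
    then show ?thesis using a qs by simp
  next
    case False
    then obtain b us c vs where bc: "ps = b # us" "qs' = c # vs"
      by (meson neq_Nil_conv)
    have P: "tree_path k x y (x # b # us)" and Q: "tree_path k x y (x # c # vs)"
      using Cons.prems a qs bc by auto
    have "b = c"
    proof (cases "b \<in> children k x")
      case True
      then have c: "c \<in> children k x" using swap P Q by blast
      have "suffix b y" "suffix c y" using tree_path_descends P Q True c by blast+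
      moreover have "length b = length c" using True c by (auto simp: children_def)
      ultimately show ?thesis by (auto simp: suffix_def)
    next
      case False
      then have c: "c \<notin> children k x" using swap P Q by blast
      then show ?thesis
        using False P Q by (auto simp: tree_path_Cons_Cons tree_adj_def children_def)
    qed
    moreover have "tree_path k b y (b # us)" "tree_path k c y (c # vs)"
      using P Q by (simp_all add: tree_path_Cons_Cons)
    ultimately have "ps = qs'" using Cons.IH bc by blast
    then show ?thesis using a qs by simp
  qed
qed

lemma tree_path_extend:
  assumes "tree_path k x y ps" "tree_adj k y z" "z \<in> tree k"
  shows "\<exists>qs. tree_path k x z qs"
proof (cases "z \<in> set ps")
  case True
  then obtain us vs where "ps = (us @ [z]) @ vs" by (metis append.assoc append_Cons append_Nil split_list)
  moreover have "successively (tree_adj k) (us @ [z])"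
    using assms(1) calculation unfolding tree_path_def by (metis successively_append_iff)
  ultimately have "tree_path k x z (us @ [z])"
    using assms(1) by (cases us) (auto simp: tree_path_def)
  then show ?thesis ..
next
  case False
  then have "tree_path k x z (ps @ [z])"
    using assms by (auto simp: tree_path_def successively_append_iff)
  then show ?thesis ..
qed

lemma tree_path_rev: "tree_path k x y ps \<Longrightarrow> tree_path k y x (rev ps)"
  by (auto simp: tree_path_def hd_rev last_rev tree_adj_def
           elim!: successively_mono)

lemma ex1_tree_path:
  assumes "x \<in> tree k" "y \<in> tree k"
  shows "\<exists>!ps. tree_path k x y ps"
proof -
  have ext: "\<exists>ps. tree_path k u v ps" if "v \<in> tree k" "\<exists>ps. tree_path k u [] ps" for u v
    using that
  proof (induction v)
    case (Cons i v)
    then have "v \<in> tree k" "tree_adj k v (i # v)"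
      by (auto simp: tree_def tree_adj_def children_def)
    with Cons show ?case by (meson tree_path_extend)
  qed simp
  have "tree_path k [] [] [[]]" by (simp add: tree_path_singleton tree_def)
  then have "\<exists>ps. tree_path k x [] ps" using ext[of x "[]"] assms(1) tree_path_rev by blast
  then have "\<exists>ps. tree_path k x y ps" using ext assms(2) by blast
  then show ?thesis using tree_path_unique by blast
qed

lemma finite_tree_ball:
  assumes "x \<in> tree k"
  shows "finite (tree_ball k x r)"
proof -
  have len: "length y \<le> length x + (length ps - 1)" if "tree_path k x y ps" for x y ps
    using that
  proof (induction ps arbitrary: x)
    case (Cons a ps)
    show ?case
    proof (cases ps)
      case Nil
      with Cons.prems show ?thesis by (auto simp: tree_path_singleton)
    next
      case (Cons b qs)
      then have "length y \<le> length b + (length ps - 1)" "length b \<le> length x + 1"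
        using Cons.IH[of b] Cons.prems
        by (auto simp: tree_path_Cons_Cons tree_adj_def children_def)
      then show ?thesis using Cons by simp
    qed
  qed (simp add: tree_path_def)
  have "tree_ball k x r \<subseteq> {y. set y \<subseteq> {..<k} \<and> length y \<le> length x + r}"
  proof
    fix y assume "y \<in> tree_ball k x r"
    then have y: "y \<in> tree k" "tree_dist k x y \<le> r" by (auto simp: tree_ball_def)
    have "length y \<le> length x + tree_dist k x y"
      unfolding tree_dist_def by (rule len) (rule theI'[OF ex1_tree_path[OF assms y(1)]])
    with y show "y \<in> {y. set y \<subseteq> {..<k} \<and> length y \<le> length x + r}"
      by (auto simp: tree_def)
  qed
  then show ?thesis using finite_lists_length_le finite_subset by blast
qed

end

theory Submission
  imports Defs
begin

text \<open>A vertex \<open>y\<close> with \<open>d(x, y) \<le> r\<close> is reached by ascending \<open>i\<close> steps to \<open>drop i x\<close> and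
  then descending \<open>m \<le> r - i\<close> steps, and balls of radius \<open>r\<close> have at least \<open>k ^ r\<close> elements.
  Hence \<open>M f x\<close> is at most a constant times the supremum over \<open>i\<close> and \<open>m\<close> of
  \<open>k ^ (- i) * \<beta> ^ m * A m f (drop i x)\<close>, where \<open>A m f z\<close> is the average of \<open>|f|\<close> over the
  \<open>k ^ m\<close> descendants of \<open>z\<close> at depth \<open>m\<close> and \<open>\<beta> > 1\<close> is arbitrary. For the weight
  \<open>k ^ ((a - 1) * length x)\<close>, Jensen's inequality bounds the \<open>u\<close>-th power of the norm of \<open>A m\<close> on
  \<open>L^u\<close> by \<open>k ^ (- a * m)\<close>, while composition with \<open>drop i\<close> costs \<open>k ^ (a * i)\<close>, against
  the gain \<open>k ^ (- u * i)\<close>. With \<open>\<beta>\<close> close to \<open>1\<close> both geometric series converge if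
  \<open>0 < a < u\<close>. At \<open>u = a\<close> the series in \<open>i\<close> diverges, but the distribution function of the
  supremum over \<open>i\<close> still gives the weak type bound, as \<open>k ^ (a * i)\<close> is then summed only over
  those \<open>i\<close> with \<open>k ^ i\<close> below a given level. The weight \<open>w\<close> has \<open>a = p\<close>, and \<open>\<sigma>\<^sub>q\<close> has
  \<open>a = 1 - (p - 1) / (q - 1)\<close>, which lies in \<open>(0, 1)\<close>.\<close>

section \<open>Distances and balls\<close>

lemma tree_dist_eq: "tree_path k x y ps \<Longrightarrow> tree_dist k x y = length ps - 1"
  unfolding tree_dist_def using tree_path_unique by (metis the_equality)

text \<open>Induction along the path. A first step up lengthens the ascent; a first step down
  cancels the first step of the ascent or, if there is no ascent, becomes the top edge of the
  descent. Cancelled edges make the length bound an inequality.\<close>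

lemma tree_path_up_down:
  assumes "tree_path k x y ps"
  shows "\<exists>u i. y = u @ drop i x \<and> i \<le> length x \<and> length u + i \<le> length ps - 1"
  using assms
proof (induction ps arbitrary: x)
  case Nil
  then show ?case by (simp add: tree_path_def)
next
  case (Cons a ps)
  show ?case
  proof (cases ps)
    case Nil
    then show ?thesis using Cons.prems by (auto simp: tree_path_singleton intro!: exI[of _ "0::nat"])
  next
    case (Cons b qs)
    then have p: "a = x" "tree_adj k x b" "tree_path k b y ps"
      using Cons.prems by (auto simp: tree_path_Cons_Cons)
    obtain u i where ui: "y = u @ drop i b" "i \<le> length b" "length u + i \<le> length ps - 1"
      using Cons.IH[OF p(3)] by blast
    have ps: "length ps \<ge> 1" using Cons by simp
    from p(2) consider (down) j where "b = j # x" | (up) j where "x = j # b"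
      by (auto simp: tree_adj_def children_def)
    then show ?thesis
    proof cases
      case down
      show ?thesis
      proof (cases i)
        case 0
        then have "y = (u @ [j]) @ drop 0 x" using ui down by simp
        then show ?thesis using ui 0 ps by (intro exI[of _ "u @ [j]"] exI[of _ 0]) auto
      next
        case (Suc i')
        then show ?thesis using ui down ps by (intro exI[of _ u] exI[of _ i']) auto
      qed
    next
      case up
      then show ?thesis using ui ps by (intro exI[of _ u] exI[of _ "Suc i"]) auto
    qed
  qed
qed

lemma tree_ball_up_down:
  assumes "x \<in> tree k" "y \<in> tree_ball k x r"
  shows "\<exists>u i. y = u @ drop i x \<and> i \<le> length x \<and> length u + i \<le> r"
proof -
  have y: "y \<in> tree k" "tree_dist k x y \<le> r" using assms(2) by (auto simp: tree_ball_def)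
  obtain ps where ps: "tree_path k x y ps" using ex1_tree_path[OF assms(1) y(1)] by blast
  then show ?thesis using tree_path_up_down[OF ps] tree_dist_eq[OF ps] y(2) by fastforce
qed

text \<open>The bound on the lengths of the vertices is carried through the induction because it
  shows that the vertex appended next is new, so the path stays \<open>distinct\<close>.\<close>

lemma tree_path_to_descendant:
  assumes "u @ x \<in> tree k"
  shows "\<exists>ps. tree_path k x (u @ x) ps \<and> length ps = Suc (length u)
    \<and> (\<forall>z\<in>set ps. length z \<le> length (u @ x))"
  using assms
proof (induction u)
  case Nil
  then show ?case by (intro exI[of _ "[x]"]) (auto simp: tree_path_singleton)
next
  case (Cons j u)
  then have "u @ x \<in> tree k" and j: "j < k" by (auto simp: tree_def)
  then obtain ps where ps: "tree_path k x (u @ x) ps" "length ps = Suc (length u)"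
    "\<forall>z\<in>set ps. length z \<le> length (u @ x)" using Cons.IH by blast
  have "(j # u) @ x \<notin> set ps" using ps(3) by fastforce
  then have "tree_path k x ((j # u) @ x) (ps @ [(j # u) @ x])"
    using ps(1) Cons.prems j
    by (auto simp: tree_path_def successively_append_iff tree_adj_def children_def)
  then show ?case using ps by (intro exI[of _ "ps @ [(j # u) @ x]"]) fastforce
qed

lemma finite_tree_level: "finite (tree_level k m)"
  and card_tree_level: "card (tree_level k m) = k ^ m"
proof -
  have "tree_level k m = {u. set u \<subseteq> {..<k} \<and> length u = m}"
    by (auto simp: tree_level_eq tree_def)
  then show "finite (tree_level k m)" "card (tree_level k m) = k ^ m"
    by (simp_all add: finite_lists_length_eq card_lists_length_eq)
qed

text \<open>The \<open>k ^ r\<close> descendants of \<open>x\<close> lying \<open>r\<close> levels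
  below it all belong to the ball.\<close>

lemma card_tree_ball_ge:
  assumes "x \<in> tree k"
  shows "k ^ r \<le> card (tree_ball k x r)"
proof -
  have "(\<lambda>u. u @ x) ` tree_level k r \<subseteq> tree_ball k x r"
  proof
    fix y assume "y \<in> (\<lambda>u. u @ x) ` tree_level k r"
    then obtain u where u: "y = u @ x" "u \<in> tree k" "length u = r" by (auto simp: tree_level_eq)
    then have y: "u @ x \<in> tree k" using assms by (auto simp: tree_def)
    then show "y \<in> tree_ball k x r"
      using tree_path_to_descendant[OF y] tree_dist_eq u by (fastforce simp: tree_ball_def)
  qed
  then have "card ((\<lambda>u. u @ x) ` tree_level k r) \<le> card (tree_ball k x r)"
    using finite_tree_ball[OF assms] card_mono by blast
  moreover have "inj_on (\<lambda>u. u @ x) (tree_level k r)" by (auto simp: inj_on_def)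
  ultimately show ?thesis by (simp add: card_image card_tree_level)
qed

section \<open>Ball averages controlled by averages over descendants\<close>

definition desc_avg :: "nat \<Rightarrow> nat \<Rightarrow> (vertex \<Rightarrow> real) \<Rightarrow> vertex \<Rightarrow> real" where
  "desc_avg k m g z = (\<Sum>u\<in>tree_level k m. g (u @ z)) / real k ^ m"

lemma desc_avg_nonneg: "(\<And>x. g x \<ge> 0) \<Longrightarrow> desc_avg k m g z \<ge> 0"
  by (simp add: desc_avg_def sum_nonneg)

text \<open>The ball is covered by the image of the triples of descent length, ascent length and
  descending word. A vertex may come from several triples, since a descent can return along the
  branch just climbed; as \<open>g\<close> is nonnegative, repetitions only enlarge the right
  side.\<close>

lemma sum_tree_ball_le:
  assumes "x \<in> tree k" "\<And>x. g x \<ge> (0::real)"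
  shows "(\<Sum>y\<in>tree_ball k x r. g y)
    \<le> (\<Sum>m\<le>r. \<Sum>i | i \<le> length x \<and> i \<le> r - m. \<Sum>u\<in>tree_level k m. g (u @ drop i x))"
proof -
  let ?S = "SIGMA m:{..r}. SIGMA i:{i. i \<le> length x \<and> i \<le> r - m}. tree_level k m"
  let ?f = "\<lambda>(m::nat, i, u). u @ drop i x"
  have fin: "finite ?S" by (intro finite_SigmaI finite_tree_level) auto
  have "tree_ball k x r \<subseteq> ?f ` ?S"
  proof
    fix y assume y: "y \<in> tree_ball k x r"
    then obtain u i where ui: "y = u @ drop i x" "i \<le> length x" "length u + i \<le> r"
      using tree_ball_up_down assms(1) by blast
    have "u \<in> tree_level k (length u)" using y ui(1) by (auto simp: tree_level_eq tree_ball_def tree_def)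
    then have "(length u, i, u) \<in> ?S" using ui by auto
    then show "y \<in> ?f ` ?S" using ui(1) by (intro image_eqI[where x = "(length u, i, u)"]) auto
  qed
  then have "(\<Sum>y\<in>tree_ball k x r. g y) \<le> (\<Sum>y\<in>?f ` ?S. g y)"
    using fin assms(2) by (intro sum_mono2) auto
  also have "\<dots> \<le> (\<Sum>s\<in>?S. g (?f s))"
    using sum_image_le[OF fin, of g ?f] assms(2) by (simp add: o_def)
  also have "\<dots> = (\<Sum>m\<le>r. \<Sum>i | i \<le> length x \<and> i \<le> r - m. \<Sum>u\<in>tree_level k m. g (u @ drop i x))"
    by (simp add: sum.Sigma finite_tree_level split_def)
  finally show ?thesis .
qed

lemma sum_power_le_twice:
  assumes "(k::real) \<ge> 2"
  shows "(\<Sum>i\<le>n. k ^ i) \<le> 2 * k ^ n"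
proof (induction n)
  case (Suc n)
  have "2 * k ^ n \<le> k ^ Suc n" using assms by simp
  then show ?case using Suc by simp
qed simp

text \<open>The factor \<open>\<beta> ^ m\<close> is the room that replaces the sum over the
  \<open>r + 1\<close> ways of splitting \<open>r\<close> into an ascent \<open>i\<close> and a descent \<open>m\<close> by a
  supremum; without it the weak endpoint estimate would be lost.\<close>

lemma ball_average_le:
  assumes k: "k \<ge> 2" and x: "x \<in> tree k" and g: "\<And>x. g x \<ge> 0" and \<beta>: "\<beta> > 1" and L: "L \<ge> 0"
    and le: "\<And>i m. i \<le> length x \<Longrightarrow> \<beta> ^ m / real k ^ i * desc_avg k m g (drop i x) \<le> L"
  shows "1 / real (card (tree_ball k x r)) * (\<Sum>y\<in>tree_ball k x r. g y) \<le> 2 / (1 - 1 / \<beta>) * L"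
proof -
  have k': "real k \<ge> 2" using k by simp
  have inner: "(\<Sum>u\<in>tree_level k m. g (u @ drop i x)) \<le> (real k / \<beta>) ^ m * L * real k ^ i"
    if "i \<le> length x" for i m
    using le[OF that, of m] k' \<beta> by (simp add: desc_avg_def field_simps power_divide)
  \<comment> \<open>The sum over \<open>i\<close> is comparable to its last term
    \<open>k ^ (r - m)\<close>, which completes \<open>k ^ m\<close> to the same
    \<open>k ^ r\<close> for every \<open>m\<close>. Only the decay \<open>(1 / \<beta>) ^ m\<close>
    is left to be summed.\<close>
  have row: "(\<Sum>i | i \<le> length x \<and> i \<le> r - m. \<Sum>u\<in>tree_level k m. g (u @ drop i x))
      \<le> 2 * real k ^ r * L * (1 / \<beta>) ^ m" if "m \<le> r" for m
  proof -
    have "(\<Sum>i | i \<le> length x \<and> i \<le> r - m. \<Sum>u\<in>tree_level k m. g (u @ drop i x))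
        \<le> (\<Sum>i | i \<le> length x \<and> i \<le> r - m. (real k / \<beta>) ^ m * L * real k ^ i)"
      using inner by (intro sum_mono) auto
    also have "\<dots> \<le> (\<Sum>i\<le>r - m. (real k / \<beta>) ^ m * L * real k ^ i)"
      using \<beta> L by (intro sum_mono2) auto
    also have "\<dots> \<le> (real k / \<beta>) ^ m * L * (2 * real k ^ (r - m))"
      unfolding sum_distrib_left[symmetric]
      using \<beta> L k' by (intro mult_left_mono sum_power_le_twice) auto
    also have "\<dots> = 2 * (real k ^ m * real k ^ (r - m)) * L * (1 / \<beta>) ^ m"
      by (simp add: power_divide)
    also have "real k ^ m * real k ^ (r - m) = real k ^ r"
      using that by (simp flip: power_add)
    finally show ?thesis .
  qed
  have geo: "(\<Sum>m\<le>r. (1 / \<beta>) ^ m) \<le> 1 / (1 - 1 / \<beta>)"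
    using \<beta> sum_le_suminf[of "\<lambda>m. (1 / \<beta>) ^ m" "{..r}"] suminf_geometric[of "1 / \<beta>"]
    by (simp add: summable_geometric)
  have "(\<Sum>y\<in>tree_ball k x r. g y) \<le> (\<Sum>m\<le>r. 2 * real k ^ r * L * (1 / \<beta>) ^ m)"
    by (rule order_trans[OF sum_tree_ball_le[of x k g, OF x g]]) (intro sum_mono row, simp)
  also have "\<dots> \<le> 2 * real k ^ r * L * (1 / (1 - 1 / \<beta>))"
    unfolding sum_distrib_left[symmetric] using geo L by (intro mult_left_mono) auto
  finally have le_r: "(\<Sum>y\<in>tree_ball k x r. g y) \<le> real k ^ r * (2 / (1 - 1 / \<beta>) * L)"
    by (simp add: field_simps)
  have C: "2 / (1 - 1 / \<beta>) * L \<ge> 0" using \<beta> L by simp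
  have "real k ^ r \<le> real (card (tree_ball k x r))"
    using card_tree_ball_ge[OF x, of r] by (metis of_nat_le_iff of_nat_power)
  then have "(\<Sum>y\<in>tree_ball k x r. g y) \<le> real (card (tree_ball k x r)) * (2 / (1 - 1 / \<beta>) * L)"
    using le_r C by (meson mult_right_mono order_trans)
  moreover have "real (card (tree_ball k x r)) > 0"
    using \<open>real k ^ r \<le> _\<close> k' by (smt (verit) zero_less_power)
  ultimately show ?thesis by (simp add: field_simps)
qed

section \<open>Sums over the tree\<close>

text \<open>Cutting a word after its first \<open>m\<close> letters is a bijection from the vertices
  of depth at least \<open>m\<close> to pairs of a word of length \<open>m\<close> and a vertex; the
  rest is Tonelli's theorem for counting measures.\<close>

lemma nn_integral_tree_level_append:
  "(\<integral>\<^sup>+z. (\<Sum>u\<in>tree_level k m. h (u @ z)) \<partial>count_space (tree k))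
    = (\<integral>\<^sup>+y. h y \<partial>count_space {y \<in> tree k. m \<le> length y})"
proof -
  let ?A = "tree k" and ?B = "tree_level k m"
  have bij: "bij_betw (\<lambda>(z, u). u @ z) (?A \<times> ?B) {y \<in> ?A. m \<le> length y}"
    by (rule bij_betwI[where g = "\<lambda>y. (drop m y, take m y)"])
       (auto simp: tree_level_eq tree_def dest: in_set_takeD in_set_dropD)
  have "(\<integral>\<^sup>+z. (\<Sum>u\<in>?B. h (u @ z)) \<partial>count_space ?A)
      = (\<integral>\<^sup>+z. \<integral>\<^sup>+u. h (u @ z) \<partial>count_space ?B \<partial>count_space ?A)"
    by (simp add: nn_integral_count_space_finite finite_tree_level)
  also have "\<dots> = (\<integral>\<^sup>+z. \<integral>\<^sup>+u. h (u @ z) * indicator (?A \<times> ?B) (z, u)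
      \<partial>count_space UNIV \<partial>count_space UNIV)"
    by (simp add: nn_integral_count_space_indicator indicator_times mult_ac flip: nn_integral_cmult)
  also have "\<dots> = (\<integral>\<^sup>+s. (case s of (z, u) \<Rightarrow> h (u @ z) * indicator (?A \<times> ?B) (z, u))
      \<partial>count_space UNIV)"
    by (simp flip: nn_integral_fst_count_space)
  also have "\<dots> = (\<integral>\<^sup>+s. h (case s of (z, u) \<Rightarrow> u @ z) \<partial>count_space (?A \<times> ?B))"
    by (simp add: nn_integral_count_space_indicator split_def)
  also have "\<dots> = (\<integral>\<^sup>+y. h y \<partial>count_space {y \<in> ?A. m \<le> length y})"
    by (rule nn_integral_bij_count_space[OF bij])
  finally show ?thesis .
qed

lemma powr_mean_le:
  assumes "finite S" "S \<noteq> {}" and u: "u \<ge> 1" and nonneg: "\<And>i. i \<in> S \<Longrightarrow> y i \<ge> (0::real)"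
  shows "((\<Sum>i\<in>S. y i) / real (card S)) powr u \<le> (\<Sum>i\<in>S. y i powr u) / real (card S)"
proof -
  have conv: "convex_on {0..} (\<lambda>x::real. x powr u)"
  proof (rule convex_onI)
    fix t x y :: real assume t: "0 < t" "t < 1" and xy: "x \<in> {0..}" "y \<in> {0..}"
    have shrink: "(s * c) powr u \<le> s * c powr u" if "0 < s" "s < 1" for s c :: real
    proof -
      have "s powr u \<le> s powr 1" using that u by (intro powr_mono') auto
      then show ?thesis using that by (simp add: powr_mult mult_right_mono)
    qed
    show "((1 - t) *\<^sub>R x + t *\<^sub>R y) powr u \<le> (1 - t) * x powr u + t * y powr u"
    \<comment> \<open>At the boundary point 0 convexity reduces to \<open>shrink\<close>, that is to
      \<open>s powr u \<le> s\<close> for \<open>s\<close> in (0, 1); two positive points fall under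
      \<open>powr_convex\<close>.\<close>
    proof (cases "x = 0 \<or> y = 0")
      case True
      then show ?thesis using shrink[of t y] shrink[of "1 - t" x] t u by auto
    next
      case False
      then show ?thesis using convex_onD[OF powr_convex[OF u], of t x y] xy t by auto
    qed
  qed simp
  show ?thesis
    using convex_on_sum[OF assms(1,2) conv, of "\<lambda>_. 1 / real (card S)" y] assms
    by (simp add: sum_divide_distrib)
qed

text \<open>The exponent is written \<open>a - 1\<close> because the total weight of the descendants of a vertex
  then grows by the factor \<open>k powr a\<close> per level.\<close>

definition pow_weight :: "nat \<Rightarrow> real \<Rightarrow> vertex \<Rightarrow> real" where
  "pow_weight k a x = real k powr ((a - 1) * real (length x))"

lemma pow_weight_nonneg [simp]: "pow_weight k a x \<ge> 0"
  by (simp add: pow_weight_def)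

lemma pow_weight_append:
  assumes "k > 0"
  shows "pow_weight k a (u @ z) * real k ^ length u = pow_weight k a z * (real k powr a) ^ length u"
proof -
  have "real k ^ length u = real k powr real (length u)"
    "(real k powr a) ^ length u = real k powr (a * real (length u))"
    using assms by (simp_all add: powr_realpow powr_power mult.commute)
  then show ?thesis by (simp add: pow_weight_def algebra_simps flip: powr_add)
qed

text \<open>After Jensen's inequality, each \<open>y\<close> of depth at least \<open>m\<close>
  receives the weight of its ancestor \<open>m\<close> levels up divided by \<open>k ^ m\<close>,
  which is \<open>(1 / k powr a) ^ m\<close> times its own weight.\<close>

lemma nn_integral_desc_avg_le:
  assumes k: "k > 0" and u: "u \<ge> 1" and g: "\<And>x. g x \<ge> 0"
  shows "(\<integral>\<^sup>+z. ennreal (desc_avg k m g z powr u * pow_weight k a z) \<partial>count_space (tree k))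
    \<le> ennreal ((1 / real k powr a) ^ m)
       * (\<integral>\<^sup>+y. ennreal (g y powr u * pow_weight k a y) \<partial>count_space (tree k))"
proof -
  let ?c = "(1 / real k powr a) ^ m"
  let ?h = "\<lambda>y. ?c * (g y powr u * pow_weight k a y)"
  have le: "desc_avg k m g z powr u * pow_weight k a z \<le> (\<Sum>v\<in>tree_level k m. ?h (v @ z))" for z
  proof -
    have ne: "tree_level k m \<noteq> {}"
      using card_tree_level[of k m] k by (metis card.empty less_numeral_extra(3) zero_less_power)
    have "desc_avg k m g z powr u \<le> (\<Sum>v\<in>tree_level k m. g (v @ z) powr u) / real k ^ m"
      using powr_mean_le[OF finite_tree_level ne u, of "\<lambda>v. g (v @ z)"] g
      by (simp add: desc_avg_def card_tree_level)
    then have "desc_avg k m g z powr u * pow_weight k a z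
        \<le> (\<Sum>v\<in>tree_level k m. g (v @ z) powr u) / real k ^ m * pow_weight k a z"
      by (rule mult_right_mono) simp
    also have "\<dots> = (\<Sum>v\<in>tree_level k m. g (v @ z) powr u * (pow_weight k a z / real k ^ m))"
      by (simp add: sum_divide_distrib sum_distrib_right)
    also have "\<dots> = (\<Sum>v\<in>tree_level k m. ?h (v @ z))"
    proof (intro sum.cong refl)
      fix v assume "v \<in> tree_level k m"
      then have "length v = m" by (simp add: tree_level_eq)
      then have "pow_weight k a z / real k ^ m = ?c * pow_weight k a (v @ z)"
        using pow_weight_append[OF k, of a v z] k by (simp add: field_simps)
      then show "g (v @ z) powr u * (pow_weight k a z / real k ^ m) = ?h (v @ z)" by simp
    qed
    finally show ?thesis .
  qed
  have nn: "?h y \<ge> 0" for y by simp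
  have "(\<integral>\<^sup>+z. ennreal (desc_avg k m g z powr u * pow_weight k a z) \<partial>count_space (tree k))
      \<le> (\<integral>\<^sup>+z. (\<Sum>v\<in>tree_level k m. ennreal (?h (v @ z))) \<partial>count_space (tree k))"
    using le nn by (intro nn_integral_mono) (simp add: sum_ennreal ennreal_leI del: mult_nonneg_nonneg)
  also have "\<dots> = (\<integral>\<^sup>+y. ennreal (?h y) \<partial>count_space {y \<in> tree k. m \<le> length y})"
    by (rule nn_integral_tree_level_append)
  also have "\<dots> \<le> (\<integral>\<^sup>+y. ennreal (?h y) \<partial>count_space (tree k))"
    by (auto simp: nn_integral_count_space_indicator intro!: nn_integral_mono split: split_indicator)
  also have "\<dots> = (\<integral>\<^sup>+y. ennreal ?c * ennreal (g y powr u * pow_weight k a y) \<partial>count_space (tree k))"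
    by (intro nn_integral_cong ennreal_mult) simp_all
  also have "\<dots> = ennreal ?c * (\<integral>\<^sup>+y. ennreal (g y powr u * pow_weight k a y) \<partial>count_space (tree k))"
    by (rule nn_integral_cmult) simp
  finally show ?thesis .
qed

text \<open>The \<open>k ^ i\<close> vertices whose ancestor \<open>i\<close> levels up is
  \<open>z\<close> have total weight \<open>(k powr a) ^ i\<close> times that of \<open>z\<close>.
  The guard \<open>i \<le> length x\<close> matters: \<open>drop i x\<close> is the root for every
  shorter \<open>x\<close>.\<close>

lemma nn_integral_ancestor:
  assumes k: "k > 0"
  shows "(\<integral>\<^sup>+x. (if i \<le> length x then h (drop i x) else 0) * ennreal (pow_weight k a x)
      \<partial>count_space (tree k))
    = ennreal ((real k powr a) ^ i) * (\<integral>\<^sup>+z. h z * ennreal (pow_weight k a z) \<partial>count_space (tree k))"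
proof -
  have "(\<integral>\<^sup>+x. (if i \<le> length x then h (drop i x) else 0) * ennreal (pow_weight k a x)
      \<partial>count_space (tree k))
      = (\<integral>\<^sup>+x. h (drop i x) * ennreal (pow_weight k a x) \<partial>count_space {x \<in> tree k. i \<le> length x})"
    by (auto simp: nn_integral_count_space_indicator intro!: nn_integral_cong split: split_indicator)
  also have "\<dots> = (\<integral>\<^sup>+z. (\<Sum>u\<in>tree_level k i. h (drop i (u @ z)) * ennreal (pow_weight k a (u @ z)))
      \<partial>count_space (tree k))"
    by (rule nn_integral_tree_level_append[symmetric])
  also have "\<dots> = (\<integral>\<^sup>+z. ennreal ((real k powr a) ^ i) * (h z * ennreal (pow_weight k a z))
      \<partial>count_space (tree k))"
  proof (intro nn_integral_cong)
    fix z
    have "(\<Sum>u\<in>tree_level k i. h (drop i (u @ z)) * ennreal (pow_weight k a (u @ z)))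
        = (\<Sum>u\<in>tree_level k i. h z * ennreal (pow_weight k a z * (real k powr a) ^ i / real k ^ i))"
    proof (intro sum.cong refl)
      fix u assume "u \<in> tree_level k i"
      then have "length u = i" by (simp add: tree_level_eq)
      moreover from this have "pow_weight k a (u @ z) = pow_weight k a z * (real k powr a) ^ i / real k ^ i"
        using pow_weight_append[OF k, of a u z] k by (simp add: field_simps)
      ultimately show "h (drop i (u @ z)) * ennreal (pow_weight k a (u @ z))
          = h z * ennreal (pow_weight k a z * (real k powr a) ^ i / real k ^ i)" by simp
    qed
    also have "\<dots> = h z * (ennreal (real (k ^ i))
        * ennreal (pow_weight k a z * (real k powr a) ^ i / real k ^ i))"
      by (simp add: card_tree_level ennreal_of_nat_eq_real_of_nat mult_ac)
    also have "\<dots> = h z * ennreal ((real k powr a) ^ i * pow_weight k a z)"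
      using k by (subst ennreal_mult[symmetric]) (auto simp: mult_ac)
    also have "\<dots> = ennreal ((real k powr a) ^ i) * (h z * ennreal (pow_weight k a z))"
      by (subst ennreal_mult) (auto simp: mult_ac)
    finally show "(\<Sum>u\<in>tree_level k i. h (drop i (u @ z)) * ennreal (pow_weight k a (u @ z)))
        = ennreal ((real k powr a) ^ i) * (h z * ennreal (pow_weight k a z))" .
  qed
  also have "\<dots> = ennreal ((real k powr a) ^ i)
      * (\<integral>\<^sup>+z. h z * ennreal (pow_weight k a z) \<partial>count_space (tree k))"
    by (rule nn_integral_cmult) simp
  finally show ?thesis .
qed

section \<open>Bounds for the maximal function\<close>

lemma maximal_le:
  assumes "k \<ge> 2" "x \<in> tree k" "\<beta> > 1" "L \<ge> 0"
    and "\<And>i m. i \<le> length x \<Longrightarrow> \<beta> ^ m / real k ^ i * desc_avg k m (\<lambda>y. norm (f y)) (drop i x) \<le> L"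
  shows "maximal k f x \<le> ennreal (2 / (1 - 1 / \<beta>) * L)"
  unfolding maximal_def
  by (intro SUP_least ennreal_leI ball_average_le) (use assms in auto)

section \<open>Powers and geometric series with values in [0, \<infinity>]\<close>

lemma epowr_mono:
  assumes "A \<le> B" "q \<ge> 0"
  shows "epowr A q \<le> epowr B q"
proof (cases B)
  case (real b)
  then obtain a where "A = ennreal a" "0 \<le> a" "a \<le> b"
    using assms(1) by (cases A) (auto simp: top_unique)
  then show ?thesis using real assms(2) by (auto simp: epowr_def intro!: ennreal_leI powr_mono2)
qed (simp add: epowr_def)

lemma epowr_cmult:
  assumes "c > 0" "q > 0"
  shows "epowr (ennreal c * A) q = ennreal (c powr q) * epowr A q"
proof (cases A)
  case (real a)
  then show ?thesis using assms
    by (simp add: epowr_def powr_mult flip: ennreal_mult)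
next
  case top
  then show ?thesis using assms by (simp add: epowr_def ennreal_mult_top)
qed

lemma epowr_ennreal: "r \<ge> 0 \<Longrightarrow> epowr (ennreal r) q = ennreal (r powr q)"
  by (simp add: epowr_def)

lemma ennreal_cmult_assoc:
  "a \<ge> 0 \<Longrightarrow> b \<ge> 0 \<Longrightarrow> ennreal a * (ennreal b * c) = ennreal (a * b) * c"
  by (simp add: ennreal_mult mult.assoc)

lemma suminf_ennreal_geometric:
  assumes "0 \<le> \<rho>" "\<rho> < 1"
  shows "(\<Sum>i. ennreal (\<rho> ^ i)) = ennreal (1 / (1 - \<rho>))"
  using assms by (intro suminf_ennreal_eq geometric_sums) auto

section \<open>Strong type estimates\<close>

lemma le_powr_inverse:
  assumes "x powr u \<le> S" "x \<ge> 0" "u > (0::real)"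
  shows "x \<le> S powr (1 / u)"
  using powr_mono2[of "1 / u" "x powr u" S] assms by (simp add: powr_powr)

text \<open>A supremum is at most the sum: if the double series has a finite value \<open>S\<close>,
  each of its terms is at most \<open>S\<close>, so \<open>S powr (1 / u)\<close> is an admissible
  \<open>L\<close> in \<open>maximal_le\<close>. Unlike the supremum, the series can be integrated
  term by term.\<close>

lemma epowr_maximal_le:
  assumes k: "k \<ge> 2" and x: "x \<in> tree k" and \<beta>: "\<beta> > 1" and u: "u > 0"
  shows "epowr (maximal k f x) u \<le> ennreal ((2 / (1 - 1 / \<beta>)) powr u)
    * (\<Sum>i m. if i \<le> length x
        then ennreal ((\<beta> ^ m / real k ^ i * desc_avg k m (\<lambda>y. norm (f y)) (drop i x)) powr u) else 0)"
    (is "_ \<le> ennreal (?C powr u) * (\<Sum>i m. ?T i m)")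
proof (cases "\<Sum>i m. ?T i m" rule: ennreal_cases)
  case (real S)
  have "?C > 0" using \<beta> by simp
  have "\<beta> ^ m / real k ^ i * desc_avg k m (\<lambda>y. norm (f y)) (drop i x) \<le> S powr (1 / u)"
    (is "?d \<le> _") if "i \<le> length x" for i m
  proof -
    have "?T i m \<le> (\<Sum>m. ?T i m)"
      using sum_le_suminf[OF summableI, of "{m}" "?T i"] by simp
    also have "\<dots> \<le> (\<Sum>i m. ?T i m)"
      using sum_le_suminf[OF summableI, of "{i}" "\<lambda>i. \<Sum>m. ?T i m"] by simp
    finally have "?d powr u \<le> S" using real that by simp
    moreover have "?d \<ge> 0" using \<beta> by (simp add: desc_avg_nonneg)
    ultimately show ?thesis using u by (intro le_powr_inverse)
  qed
  then have "maximal k f x \<le> ennreal (?C * S powr (1 / u))"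
    using maximal_le[OF k x \<beta>, of "S powr (1 / u)" f] by simp
  then have "epowr (maximal k f x) u \<le> epowr (ennreal (?C * S powr (1 / u))) u"
    using u by (intro epowr_mono) auto
  also have "\<dots> = ennreal ((?C * S powr (1 / u)) powr u)"
    using \<open>?C > 0\<close> by (intro epowr_ennreal) auto
  also have "(?C * S powr (1 / u)) powr u = ?C powr u * S"
    unfolding powr_mult powr_powr using real u by simp
  also have "\<dots> = ennreal (?C powr u) * (\<Sum>i m. ?T i m)"
    using real by (simp add: ennreal_mult)
  finally show ?thesis .
next
  case top
  \<comment> \<open>Strict positivity is what makes the right side infinite, since 0 times
    \<infinity> is 0 in \<open>ennreal\<close>.\<close>
  have "?C powr u > 0" using \<beta> by simp
  then have "ennreal (?C powr u) * top = top"
    by (metis ennreal_eq_0_iff ennreal_mult_top not_le)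
  then show ?thesis unfolding top infinity_ennreal_def by (simp only: top_greatest)
qed

lemma maximal_strong_type:
  assumes k: "k \<ge> 2" and u: "u \<ge> 1" and a: "0 < a" "a < u"
  shows "\<exists>K>0. \<forall>f. (\<integral>\<^sup>+x. epowr (maximal k f x) u * ennreal (pow_weight k a x) \<partial>count_space (tree k))
    \<le> ennreal K * (\<integral>\<^sup>+x. ennreal (norm (f x) powr u * pow_weight k a x) \<partial>count_space (tree k))"
proof -
  have k1: "real k > 1" using k by simp
  \<comment> \<open>Chosen so that \<open>\<beta> powr u = k powr (a / 2)\<close>: the factor
    \<open>\<beta> ^ m\<close> spends half of the decay \<open>k powr (- a * m)\<close> of the
    averages, and \<open>\<theta>\<close> is the ratio that remains. The ratio \<open>\<rho>\<close>
    weighs the cost \<open>k powr a\<close> of an ascending step against its gain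
    \<open>k powr (- u)\<close>.\<close>
  define \<beta> where "\<beta> = real k powr (a / (2 * u))"
  define C where "C = 2 / (1 - 1 / \<beta>)"
  define \<rho> where "\<rho> = real k powr (a - u)"
  define \<theta> where "\<theta> = real k powr (- a / 2)"
  have \<beta>: "\<beta> > 1" unfolding \<beta>_def using k1 a u by (intro gr_one_powr) auto
  have \<rho>: "0 \<le> \<rho>" "\<rho> < 1" unfolding \<rho>_def using k1 a by (auto intro: powr_less_one)
  have \<theta>: "0 \<le> \<theta>" "\<theta> < 1" unfolding \<theta>_def using k1 a by (auto intro: powr_less_one)
  have C: "C > 0" using \<beta> by (simp add: C_def)
  define K where "K = C powr u * (1 / (1 - \<rho>) * (1 / (1 - \<theta>)))"
  have coef: "(\<beta> ^ m / real k ^ i) powr u * (real k powr a) ^ i * (1 / real k powr a) ^ m = \<rho> ^ i * \<theta> ^ m"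
    for i m
  proof -
    have "(\<beta> ^ m) powr u = real k powr (a * real m / 2)"
      using k1 u by (simp add: \<beta>_def powr_power powr_powr mult.commute)
    moreover have "(real k ^ i) powr u = real k powr (u * real i)"
      using k1 by (simp add: powr_powr mult.commute flip: powr_realpow)
    moreover have "(1 / real k powr a) ^ m = real k powr (- a * real m)"
      using k1 by (simp add: power_divide powr_power powr_minus_divide mult.commute)
    moreover have "(real k powr a) ^ i = real k powr (a * real i)"
      "\<rho> ^ i = real k powr ((a - u) * real i)" "\<theta> ^ m = real k powr (- a / 2 * real m)"
      using k1 by (simp_all add: \<rho>_def \<theta>_def powr_power mult.commute)
    ultimately show ?thesis
      unfolding powr_divide by (simp add: algebra_simps flip: powr_add powr_diff)
  qed
  have main: "(\<integral>\<^sup>+x. epowr (maximal k f x) u * ennreal (pow_weight k a x) \<partial>count_space (tree k))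
      \<le> ennreal K * (\<integral>\<^sup>+x. ennreal (norm (f x) powr u * pow_weight k a x) \<partial>count_space (tree k))"
    (is "?lhs \<le> ennreal K * ?I") for f
  proof -
    let ?D = "\<lambda>m. desc_avg k m (\<lambda>y. norm (f y))"
    let ?h = "\<lambda>i m z. ennreal ((\<beta> ^ m / real k ^ i * ?D m z) powr u)"
    let ?T = "\<lambda>i m x. if i \<le> length x then ?h i m (drop i x) else 0"
    \<comment> \<open>\<open>nn_integral_ancestor\<close> moves the integral from \<open>x\<close>
      to its ancestor, \<open>nn_integral_desc_avg_le\<close> treats the average there, and
      \<open>coef\<close> collects the powers of \<open>k\<close>.\<close>
    have piece: "(\<integral>\<^sup>+x. ?T i m x * ennreal (pow_weight k a x) \<partial>count_space (tree k))
        \<le> ennreal (\<rho> ^ i) * ennreal (\<theta> ^ m) * ?I" for i m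
    proof -
      let ?c = "(\<beta> ^ m / real k ^ i) powr u"
      have "(\<integral>\<^sup>+x. ?T i m x * ennreal (pow_weight k a x) \<partial>count_space (tree k))
          = ennreal ((real k powr a) ^ i) * (\<integral>\<^sup>+z. ?h i m z * ennreal (pow_weight k a z) \<partial>count_space (tree k))"
        using k by (intro nn_integral_ancestor) auto
      also have "(\<integral>\<^sup>+z. ?h i m z * ennreal (pow_weight k a z) \<partial>count_space (tree k))
          = (\<integral>\<^sup>+z. ennreal ?c * ennreal (?D m z powr u * pow_weight k a z) \<partial>count_space (tree k))"
        using \<beta> by (intro nn_integral_cong)
          (simp add: powr_mult powr_divide desc_avg_nonneg mult_ac flip: ennreal_mult)
      also have "\<dots> = ennreal ?c * (\<integral>\<^sup>+z. ennreal (?D m z powr u * pow_weight k a z) \<partial>count_space (tree k))"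
        by (rule nn_integral_cmult) simp
      also have "ennreal ((real k powr a) ^ i) * \<dots>
          \<le> ennreal ((real k powr a) ^ i) * (ennreal ?c * (ennreal ((1 / real k powr a) ^ m) * ?I))"
        using k u by (intro mult_left_mono nn_integral_desc_avg_le) auto
      also have "\<dots> = ennreal (?c * (real k powr a) ^ i * (1 / real k powr a) ^ m) * ?I"
        by (simp add: ennreal_mult mult_ac)
      also have "\<dots> = ennreal (\<rho> ^ i) * ennreal (\<theta> ^ m) * ?I"
        unfolding coef using \<rho> \<theta> by (simp add: ennreal_mult)
      finally show ?thesis .
    qed
    have "?lhs \<le> (\<integral>\<^sup>+x. ennreal (C powr u) * (\<Sum>i m. ?T i m x * ennreal (pow_weight k a x))
        \<partial>count_space (tree k))"
    proof (intro nn_integral_mono)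
      fix x assume "x \<in> space (count_space (tree k))"
      then have "epowr (maximal k f x) u \<le> ennreal (C powr u) * (\<Sum>i m. ?T i m x)"
        using epowr_maximal_le[OF k _ \<beta>] u by (simp add: C_def)
      then show "epowr (maximal k f x) u * ennreal (pow_weight k a x)
          \<le> ennreal (C powr u) * (\<Sum>i m. ?T i m x * ennreal (pow_weight k a x))"
        by (simp add: mult.assoc[symmetric] mult_right_mono)
    qed
    also have "\<dots> = ennreal (C powr u) * (\<Sum>i m. \<integral>\<^sup>+x. ?T i m x * ennreal (pow_weight k a x)
        \<partial>count_space (tree k))"
      by (subst nn_integral_cmult, simp, subst nn_integral_suminf, simp, subst nn_integral_suminf) simp_all
    also have "\<dots> \<le> ennreal (C powr u) * (\<Sum>i m. ennreal (\<rho> ^ i) * ennreal (\<theta> ^ m) * ?I)"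
      by (intro mult_left_mono suminf_le summableI piece) simp
    also have "\<dots> = ennreal (C powr u) * (ennreal (1 / (1 - \<rho>)) * ennreal (1 / (1 - \<theta>)) * ?I)"
      using suminf_ennreal_geometric[OF \<rho>] suminf_ennreal_geometric[OF \<theta>] by (simp add: mult.assoc)
    also have "\<dots> = ennreal K * ?I"
      unfolding K_def using \<rho> \<theta>
      by (subst ennreal_mult[symmetric], simp, simp, subst ennreal_cmult_assoc) simp_all
    finally show ?thesis .
  qed
  have "K > 0" unfolding K_def using C \<rho> \<theta> by simp
  with main show ?thesis by blast
qed

section \<open>The weak type estimate at the endpoint\<close>

text \<open>Only finitely many terms survive, and a geometric sum with ratio above 1 is comparable
  to its last term, whose index \<open>n\<close> satisfies \<open>k ^ n < s\<close>. This replaces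
  the geometric series in \<open>i\<close>, which has ratio 1 at the endpoint.\<close>

lemma suminf_powers_below:
  assumes k: "k > (1::real)" and a: "a > 0"
  shows "(\<Sum>i. if k ^ i < s then ennreal ((k powr a) ^ i) else 0)
    \<le> ennreal (k powr a / (k powr a - 1) * s powr a)"
proof -
  let ?b = "k powr a"
  have b: "?b > 1" using k a by (intro gr_one_powr) auto
  define A where "A = {i. k ^ i < s}"
  obtain N where N: "s < k ^ N" using real_arch_pow[OF k] by blast
  have "A \<subseteq> {..N}"
  proof
    fix i assume "i \<in> A"
    then have "k ^ i < k ^ N" using N by (simp add: A_def)
    then show "i \<in> {..N}" using k by (simp add: power_strict_increasing_iff)
  qed
  then have fin: "finite A" using finite_subset by blast
  have "(\<Sum>i. if k ^ i < s then ennreal (?b ^ i) else 0) = (\<Sum>i\<in>A. if k ^ i < s then ennreal (?b ^ i) else 0)"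
    by (rule suminf_finite[OF fin]) (simp add: A_def)
  also have "\<dots> = ennreal (\<Sum>i\<in>A. ?b ^ i)"
    by (simp add: A_def flip: sum_ennreal)
  also have "(\<Sum>i\<in>A. ?b ^ i) \<le> ?b / (?b - 1) * s powr a"
  proof (cases "A = {}")
    case False
    define n where "n = Max A"
    have n: "n \<in> A" "A \<subseteq> {..n}" using fin False by (auto simp: n_def)
    have "(\<Sum>i\<in>A. ?b ^ i) \<le> (\<Sum>i\<le>n. ?b ^ i)" using n b by (intro sum_mono2) auto
    also have "\<dots> = (?b ^ Suc n - 1) / (?b - 1)"
      using b geometric_sum[of ?b "Suc n"] by (simp only: lessThan_Suc_atMost)
    also have "\<dots> \<le> ?b ^ Suc n / (?b - 1)"
      using b by (intro divide_right_mono) auto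
    also have "\<dots> = ?b / (?b - 1) * (k ^ n) powr a"
      using k by (simp add: powr_power powr_powr mult.commute flip: powr_realpow)
    also have "\<dots> \<le> ?b / (?b - 1) * s powr a"
    proof (intro mult_left_mono powr_mono2)
      show "0 \<le> ?b / (?b - 1)" by (rule divide_nonneg_nonneg) (use b in linarith)+
    qed (use n(1) k a in \<open>auto simp: A_def\<close>)
    finally show ?thesis .
  qed (use b in simp)
  finally show ?thesis by (simp add: ennreal_leI)
qed

lemma maximal_weak_type:
  assumes k: "k \<ge> 2" and a: "a \<ge> 1"
  shows "\<exists>K>0. \<forall>f. \<forall>l>0.
    ennreal (l powr a) * weight_of (pow_weight k a) {x \<in> tree k. maximal k f x > ennreal l}
    \<le> ennreal K * (\<integral>\<^sup>+x. ennreal (norm (f x) powr a * pow_weight k a x) \<partial>count_space (tree k))"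
proof -
  have k1: "real k > 1" using k by simp
  \<comment> \<open>The choice made for the strong type, \<open>k powr (a / (2 * u))\<close>, at
    \<open>u = a\<close>.\<close>
  define \<beta> where "\<beta> = real k powr (1 / 2)"
  define C where "C = 2 / (1 - 1 / \<beta>)"
  define \<theta> where "\<theta> = real k powr (- a / 2)"
  define K0 where "K0 = real k powr a / (real k powr a - 1)"
  have \<beta>: "\<beta> > 1" unfolding \<beta>_def using k1 by (intro gr_one_powr) auto
  have \<theta>: "0 \<le> \<theta>" "\<theta> < 1" unfolding \<theta>_def using k1 a by (auto intro: powr_less_one)
  have C: "C > 0" using \<beta> by (simp add: C_def)
  have "real k powr a > 1" using k1 a by (intro gr_one_powr) auto
  then have K0: "K0 > 0" using k by (simp add: K0_def zero_less_divide_iff)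
  define K where "K = K0 * C powr a * (1 / (1 - \<theta>))"
  have coef: "(\<beta> ^ m) powr a * (1 / real k powr a) ^ m = \<theta> ^ m" for m
  proof -
    have "(\<beta> ^ m) powr a = real k powr (a * real m / 2)"
      using k1 by (simp add: \<beta>_def powr_power powr_powr mult.commute)
    moreover have "(1 / real k powr a) ^ m = real k powr (- a * real m)"
      using k1 by (simp add: power_divide powr_power powr_minus_divide mult.commute)
    ultimately show ?thesis using k1
      by (simp add: \<theta>_def powr_power field_simps powr_minus flip: powr_add)
  qed
  have main: "ennreal (l powr a) * weight_of (pow_weight k a) {x \<in> tree k. maximal k f x > ennreal l}
      \<le> ennreal K * (\<integral>\<^sup>+x. ennreal (norm (f x) powr a * pow_weight k a x) \<partial>count_space (tree k))"
    (is "_ * ?W \<le> ennreal K * ?I") if l: "l > 0" for f l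
  proof -
    let ?D = "\<lambda>m. desc_avg k m (\<lambda>y. norm (f y))"
    \<comment> \<open>Solving \<open>l / C < \<beta> ^ m / k ^ i * ?D m z\<close> for
      \<open>k ^ i\<close> gives this threshold, which is independent of \<open>i\<close>.\<close>
    let ?s = "\<lambda>m z. \<beta> ^ m * C / l * ?D m z"
    let ?G = "\<lambda>m i z. (if real k ^ i < ?s m z then 1 else 0) :: ennreal"
    let ?T = "\<lambda>m i x. if i \<le> length x then ?G m i (drop i x) else 0"
    let ?v = "\<lambda>x. ennreal (pow_weight k a x)"
    \<comment> \<open>Contrapositive of \<open>maximal_le\<close> with \<open>L = l / C\<close>: a
      point of the level set must violate the bound for some \<open>i\<close> and
      \<open>m\<close>.\<close>
    have cover: "1 \<le> (\<Sum>m i. ?T m i x)" if x: "x \<in> tree k" and big: "maximal k f x > ennreal l" for x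
    proof -
      have "\<exists>i m. i \<le> length x \<and> \<beta> ^ m / real k ^ i * ?D m (drop i x) > l / C"
      proof (rule ccontr)
        assume "\<not> ?thesis"
        then have "maximal k f x \<le> ennreal (C * (l / C))"
          unfolding C_def using l C by (intro maximal_le[OF k x \<beta>]) (auto simp: C_def not_less)
        then show False using big C by simp
      qed
      then obtain i m where im: "i \<le> length x" "l / C < \<beta> ^ m / real k ^ i * ?D m (drop i x)" by blast
      then have "?T m i x = 1" using C l k1 by (simp add: field_simps)
      then have "1 \<le> (\<Sum>i. ?T m i x)"
        using sum_le_suminf[OF summableI, of "{i}" "\<lambda>i. ?T m i x"] by simp
      also have "\<dots> \<le> (\<Sum>m i. ?T m i x)"
        using sum_le_suminf[OF summableI, of "{m}" "\<lambda>m. \<Sum>i. ?T m i x"] by simp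
      finally show ?thesis .
    qed
    have level: "(\<Sum>i. \<integral>\<^sup>+x. ?T m i x * ?v x \<partial>count_space (tree k))
        \<le> ennreal (K0 * (C / l) powr a) * ennreal (\<theta> ^ m) * ?I" for m
    proof -
      have "(\<Sum>i. \<integral>\<^sup>+x. ?T m i x * ?v x \<partial>count_space (tree k))
          = (\<Sum>i. ennreal ((real k powr a) ^ i) * (\<integral>\<^sup>+z. ?G m i z * ?v z \<partial>count_space (tree k)))"
        using k by (intro suminf_cong nn_integral_ancestor) auto
      also have "\<dots> = (\<Sum>i. \<integral>\<^sup>+z. ennreal ((real k powr a) ^ i) * (?G m i z * ?v z) \<partial>count_space (tree k))"
        by (intro suminf_cong nn_integral_cmult[symmetric]) simp
      \<comment> \<open>The sum over \<open>i\<close> goes inside the integral before anything is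
        estimated: at a fixed \<open>z\<close> only ascents with \<open>k ^ i\<close> below
        \<open>?s m z\<close> remain, and their total cost is of order
        \<open>?s m z powr a\<close>.\<close>
      also have "\<dots> = (\<integral>\<^sup>+z. (\<Sum>i. ennreal ((real k powr a) ^ i) * (?G m i z * ?v z)) \<partial>count_space (tree k))"
        by (rule nn_integral_suminf[symmetric]) simp
      also have "\<dots> \<le> (\<integral>\<^sup>+z. ennreal (K0 * (\<beta> ^ m * C / l) powr a)
          * ennreal (?D m z powr a * pow_weight k a z) \<partial>count_space (tree k))"
      proof (intro nn_integral_mono)
        fix z
        have "(\<Sum>i. ennreal ((real k powr a) ^ i) * (?G m i z * ?v z))
            = (\<Sum>i. if real k ^ i < ?s m z then ennreal ((real k powr a) ^ i) else 0) * ?v z"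
          unfolding ennreal_suminf_multc[symmetric] by (intro suminf_cong) simp
        also have "\<dots> \<le> ennreal (K0 * ?s m z powr a) * ?v z"
          unfolding K0_def using k1 a by (intro mult_right_mono suminf_powers_below) auto
        also have "\<dots> = ennreal (K0 * (\<beta> ^ m * C / l) powr a) * ennreal (?D m z powr a * pow_weight k a z)"
          unfolding powr_mult[of _ "?D m z"] using K0
          by (subst (1 2) ennreal_mult[symmetric]) (simp_all add: mult.assoc)
        finally show "(\<Sum>i. ennreal ((real k powr a) ^ i) * (?G m i z * ?v z)) \<le> \<dots>" .
      qed
      also have "\<dots> = ennreal (K0 * (\<beta> ^ m * C / l) powr a)
          * (\<integral>\<^sup>+z. ennreal (?D m z powr a * pow_weight k a z) \<partial>count_space (tree k))"
        by (rule nn_integral_cmult) simp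
      also have "\<dots> \<le> ennreal (K0 * (\<beta> ^ m * C / l) powr a) * (ennreal ((1 / real k powr a) ^ m) * ?I)"
        using k a by (intro mult_left_mono nn_integral_desc_avg_le) auto
      also have "\<dots> = ennreal (K0 * (C / l) powr a * ((\<beta> ^ m) powr a * (1 / real k powr a) ^ m)) * ?I"
        using K0 by (subst ennreal_cmult_assoc) (simp_all add: powr_mult powr_divide mult_ac)
      also have "\<dots> = ennreal (K0 * (C / l) powr a) * ennreal (\<theta> ^ m) * ?I"
        unfolding coef using K0 \<theta> by (simp add: ennreal_mult)
      finally show ?thesis .
    qed
    have "?W \<le> (\<integral>\<^sup>+x. (\<Sum>m i. ?T m i x * ?v x) \<partial>count_space (tree k))"
    proof -
      have "?W = (\<integral>\<^sup>+x. (if maximal k f x > ennreal l then 1 else 0) * ?v x \<partial>count_space (tree k))"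
        unfolding weight_of_def
        by (auto simp: nn_integral_count_space_indicator intro!: nn_integral_cong split: split_indicator)
      also have "\<dots> \<le> (\<integral>\<^sup>+x. (\<Sum>m i. ?T m i x) * ?v x \<partial>count_space (tree k))"
        using cover by (intro nn_integral_mono mult_right_mono) auto
      finally show ?thesis by simp
    qed
    also have "\<dots> = (\<Sum>m i. \<integral>\<^sup>+x. ?T m i x * ?v x \<partial>count_space (tree k))"
      by (subst nn_integral_suminf, simp, subst nn_integral_suminf) simp_all
    also have "\<dots> \<le> (\<Sum>m. ennreal (K0 * (C / l) powr a) * ennreal (\<theta> ^ m) * ?I)"
      by (intro suminf_le summableI level)
    also have "\<dots> = ennreal (K0 * (C / l) powr a) * ennreal (1 / (1 - \<theta>)) * ?I"
      using suminf_ennreal_geometric[OF \<theta>] by (simp add: mult.assoc)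
    finally have "ennreal (l powr a) * ?W
        \<le> ennreal (l powr a) * (ennreal (K0 * (C / l) powr a) * ennreal (1 / (1 - \<theta>)) * ?I)"
      by (rule mult_left_mono) simp
    also have "\<dots> = ennreal (l powr a * (K0 * (C / l) powr a) * (1 / (1 - \<theta>))) * ?I"
      using K0 \<theta>
      by (subst ennreal_mult[symmetric], simp, simp, subst ennreal_cmult_assoc) (simp_all add: mult.assoc)
    also have "l powr a * (K0 * (C / l) powr a) * (1 / (1 - \<theta>)) = K"
      unfolding K_def using l by (simp add: powr_divide)
    finally show ?thesis .
  qed
  have "K > 0" unfolding K_def using C K0 \<theta> by simp
  with main show ?thesis by blast
qed

section \<open>From integral estimates to norms\<close>

text \<open>The weight \<open>v\<close> is compared with \<open>pow_weight\<close> on vertices only,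
  because the series defining \<open>w\<close> vanishes at words outside the tree while
  \<open>pow_weight\<close> is positive there.\<close>

lemma Lq_norm_maximal_bound:
  assumes k: "k \<ge> 2" and u: "u \<ge> 1" and a: "0 < a" "a < u"
    and v: "\<And>x. x \<in> tree k \<Longrightarrow> v x = pow_weight k a x"
  shows "\<exists>C::real. C \<ge> 0 \<and> (\<forall>f :: vertex \<Rightarrow> complex.
    Lq_norm k u v (maximal k f) \<le> ennreal C * Lq_norm k u v (\<lambda>x. ennreal (norm (f x))))"
proof -
  obtain K where K: "K > 0"
    and le: "\<And>f. (\<integral>\<^sup>+x. epowr (maximal k f x) u * ennreal (pow_weight k a x) \<partial>count_space (tree k))
      \<le> ennreal K * (\<integral>\<^sup>+x. ennreal (norm (f x) powr u * pow_weight k a x) \<partial>count_space (tree k))"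
    using maximal_strong_type[OF k u a] by blast
  have "Lq_norm k u v (maximal k f)
      \<le> ennreal (K powr (1 / u)) * Lq_norm k u v (\<lambda>x. ennreal (norm (f x)))" for f
    using epowr_mono[OF le, of "1 / u" f] K u v
    by (simp add: Lq_norm_def epowr_ennreal epowr_cmult ennreal_mult cong: nn_integral_cong_simp)
  then show ?thesis by (intro exI[of _ "K powr (1 / u)"]) simp
qed

lemma weak_Lq_norm_maximal_bound:
  assumes k: "k \<ge> 2" and a: "a \<ge> 1"
    and v: "\<And>x. x \<in> tree k \<Longrightarrow> v x = pow_weight k a x"
  shows "\<exists>C::real. C \<ge> 0 \<and> (\<forall>f :: vertex \<Rightarrow> complex.
    weak_Lq_norm k a v (maximal k f) \<le> ennreal C * Lq_norm k a v (\<lambda>x. ennreal (norm (f x))))"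
proof -
  obtain K where K: "K > 0" and le: "\<And>f l. l > 0 \<Longrightarrow>
      ennreal (l powr a) * weight_of (pow_weight k a) {x \<in> tree k. maximal k f x > ennreal l}
      \<le> ennreal K * (\<integral>\<^sup>+x. ennreal (norm (f x) powr a * pow_weight k a x) \<partial>count_space (tree k))"
    using maximal_weak_type[OF k a] by blast
  have "weak_Lq_norm k a v (maximal k f)
      \<le> ennreal (K powr (1 / a)) * Lq_norm k a v (\<lambda>x. ennreal (norm (f x)))" for f
    unfolding weak_Lq_norm_def
  proof (rule SUP_least)
    fix l :: real assume "l \<in> {0<..}"
    then have l: "l > 0" by simp
    let ?A = "{x \<in> tree k. maximal k f x > ennreal l}"
    have "weight_of v ?A = weight_of (pow_weight k a) ?A"
      unfolding weight_of_def using v by (intro nn_integral_cong) simp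
    \<comment> \<open>The level \<open>l\<close> enters the root as \<open>l powr a\<close>, the
      form in which the weak type integral estimate is stated.\<close>
    then have "ennreal l * epowr (weight_of v ?A) (1 / a)
        = epowr (ennreal (l powr a) * weight_of (pow_weight k a) ?A) (1 / a)"
      using l a by (simp add: epowr_cmult powr_powr)
    also have "\<dots> \<le> epowr (ennreal K
        * (\<integral>\<^sup>+x. ennreal (norm (f x) powr a * pow_weight k a x) \<partial>count_space (tree k))) (1 / a)"
      using le[OF l] a by (intro epowr_mono) auto
    also have "\<dots> = ennreal (K powr (1 / a)) * Lq_norm k a v (\<lambda>x. ennreal (norm (f x)))"
      using K a v by (simp add: Lq_norm_def epowr_ennreal epowr_cmult ennreal_mult cong: nn_integral_cong_simp)
    finally show "ennreal l * epowr (weight_of v ?A) (1 / a) \<le> \<dots>" .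
  qed
  then show ?thesis by (intro exI[of _ "K powr (1 / a)"]) simp
qed

text \<open>The levels are disjoint, so only the term \<open>j = length x\<close> is
  nonzero.\<close>

lemma suminf_level_eq_pow_weight:
  assumes "x \<in> tree k"
  shows "(\<Sum>j. real k powr (real j * (p - 1)) * indicator (tree_level k j) x) = pow_weight k p x"
proof -
  have "(\<Sum>j. real k powr (real j * (p - 1)) * indicator (tree_level k j) x)
      = (\<Sum>j\<in>{length x}. real k powr (real j * (p - 1)) * indicator (tree_level k j) x)"
    by (rule suminf_finite) (auto simp: tree_level_eq)
  then show ?thesis using assms by (simp add: tree_level_eq pow_weight_def mult.commute)
qed

theorem corollary2p1:
  fixes k :: nat and p :: real and w :: "vertex \<Rightarrow> real"
  assumes "k \<ge> 2" and "p > 1"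
    and "w = (\<lambda>x. \<Sum>j. real k powr (real j * (p - 1)) * indicator (tree_level k j) x)"
  shows "(\<exists>C::real. C \<ge> 0 \<and> (\<forall>f :: vertex \<Rightarrow> complex.
            weak_Lq_norm k p w (maximal k f)
              \<le> ennreal C * Lq_norm k p w (\<lambda>x. ennreal (norm (f x)))))
       \<and> (\<forall>q>p. \<forall>\<sigma> q'. \<sigma> = (\<lambda>x. w x powr (- (1 / (q - 1)))) \<longrightarrow> q' = q / (q - 1) \<longrightarrow>
            (\<exists>C::real. C \<ge> 0 \<and> (\<forall>f :: vertex \<Rightarrow> complex.
               Lq_norm k q w (maximal k f)
                 \<le> ennreal C * Lq_norm k q w (\<lambda>x. ennreal (norm (f x)))))
          \<and> (\<exists>C::real. C \<ge> 0 \<and> (\<forall>f :: vertex \<Rightarrow> complex.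
               Lq_norm k q' \<sigma> (maximal k f)
                 \<le> ennreal C * Lq_norm k q' \<sigma> (\<lambda>x. ennreal (norm (f x))))))"
proof -
  have w: "w x = pow_weight k p x" if "x \<in> tree k" for x
    using suminf_level_eq_pow_weight[OF that] assms(3) by simp
  \<comment> \<open>The exponent of \<open>k\<close> per level is
    \<open>- (p - 1) / (q - 1)\<close>, and it has to be read as \<open>a - 1\<close>.\<close>
  have dual: "w x powr (- (1 / (q - 1))) = pow_weight k (1 - (p - 1) / (q - 1)) x"
    if "x \<in> tree k" for q x
    using w[OF that] by (simp add: pow_weight_def powr_powr)
  show ?thesis
  proof (intro conjI allI impI)
    show "\<exists>C::real. C \<ge> 0 \<and> (\<forall>f :: vertex \<Rightarrow> complex.
        weak_Lq_norm k p w (maximal k f) \<le> ennreal C * Lq_norm k p w (\<lambda>x. ennreal (norm (f x))))"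
      using assms w by (intro weak_Lq_norm_maximal_bound) auto
  next
    fix q :: real and \<sigma> :: "vertex \<Rightarrow> real" and q' :: real
    assume q: "p < q" and \<sigma>: "\<sigma> = (\<lambda>x. w x powr (- (1 / (q - 1))))" and q': "q' = q / (q - 1)"
    show "\<exists>C::real. C \<ge> 0 \<and> (\<forall>f :: vertex \<Rightarrow> complex.
        Lq_norm k q w (maximal k f) \<le> ennreal C * Lq_norm k q w (\<lambda>x. ennreal (norm (f x))))"
      using assms q w by (intro Lq_norm_maximal_bound[where a = p]) auto
    \<comment> \<open>Here \<open>p < q\<close> gives \<open>a > 0\<close>, while
      \<open>p > 1\<close> gives \<open>a < 1\<close>, hence \<open>a < q'\<close>: the strong type
      range for \<sigma> with exponent \<open>q'\<close>.\<close>
    have "1 \<le> q'" "0 < 1 - (p - 1) / (q - 1)" "1 - (p - 1) / (q - 1) < q'"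
      using q assms(2) by (simp_all add: q' field_simps)
    then show "\<exists>C::real. C \<ge> 0 \<and> (\<forall>f :: vertex \<Rightarrow> complex.
        Lq_norm k q' \<sigma> (maximal k f) \<le> ennreal C * Lq_norm k q' \<sigma> (\<lambda>x. ennreal (norm (f x))))"
      using assms(1) dual unfolding \<sigma> by (intro Lq_norm_maximal_bound) auto
  qed
qed

end
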